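(* Let $q$ be a prime power and let $\alpha,\beta\in\mathbb{F}_{q^5}$ with $\alpha^q\neq\beta^{q+1}$ be such that the linear set $$L_{\alpha,\beta}=\{\langle(x-\alpha x^{q^2},\,x^q-\beta x^{q^2})\rangle_{\mathbb{F}_{q^5}}: x\in\mathbb{F}_{q^5}^*\}$$ is maximum scattered. Then $L_{\alpha,\beta}$ is equivalent to $L_1^{\eta}=\{\langle(x,\eta x^q+x^{q^4})\rangle_{\mathbb{F}_{q^5}}: x\in\mathbb{F}_{q^5}^*\}$ for some $\eta\in\mathbb{F}_{q^5}$ with $\mathrm{N}(\eta)\notin\{0,1\}$ if and only if $\beta=0$ and $\mathrm{N}(\alpha)\neq-1$.
   Context: $L_{\alpha,\beta}$ is the $\mathbb{F}_q$-linear set in $\mathrm{PG}(1,q^5)$ associated with the $\mathbb{F}_q$-subspace $U_{\alpha,\beta}=\{(x-\alpha x^{q^2},x^q-\beta x^{q^2}): x\in\mathbb{F}_{q^5}\}$ of $\mathbb{F}_{q^5}^2$; its rank is $\dim_{\mathbb{F}_q}U_{\alpha,\beta}$. A linear set of rank $r$ is scattered if it has exactly $(q^r-1)/(q-1)$ points; a scattered linear set of rank $5$ in $\mathrm{PG}(1,q^5)$ is maximum scattered. Equivalence of linear sets (as point sets of $\mathrm{PG}(1,q^5)$) is under the collineation group $\mathrm{P\Gamma L}(2,q^5)$. $\mathrm{N}$ is the norm from $\mathbb{F}_{q^5}$ to $\mathbb{F}_q$. *)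

theory Defs
  imports "HOL-Analysis.Analysis" "HOL-Number_Theory.Number_Theory"
begin

text \<open>
  The field of order \<open>q ^ 5\<close> is a type \<open>'a :: {field, finite}\<close> with \<open>CARD('a) = q ^ 5\<close>; its subfield
  of order \<open>q\<close> consists of the roots of \<open>c ^ q = c\<close>.  The underlying vector space of the projective
  line is \<open>'a ^ 2\<close>.
\<close>

definition Fq :: "nat \<Rightarrow> 'a::field set" where
  "Fq q = {c. c ^ q = c}"

definition norm5 :: "nat \<Rightarrow> 'a::field \<Rightarrow> 'a" where
  "norm5 q x = (\<Prod>i<5. x ^ (q ^ i))"

text \<open>
  The subfield is a set and not a type, so the linear algebra over it (linear combinations with
  coefficients in \<open>Fq q\<close>) is not an instance of the library locale \<open>vector_space\<close>.
\<close>

definition Fq_span :: "nat \<Rightarrow> ('a::field ^ 2) set \<Rightarrow> ('a ^ 2) set" where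
  "Fq_span q B = {(\<Sum>b\<in>B. c b *s b) | c. \<forall>b\<in>B. c b \<in> Fq q}"

definition Fq_independent :: "nat \<Rightarrow> ('a::field ^ 2) set \<Rightarrow> bool" where
  "Fq_independent q B \<longleftrightarrow>
     (\<forall>c. (\<forall>b\<in>B. c b \<in> Fq q) \<and> (\<Sum>b\<in>B. c b *s b) = 0 \<longrightarrow> (\<forall>b\<in>B. c b = 0))"

definition Fq_subspace_of_dim :: "nat \<Rightarrow> ('a::field ^ 2) set \<Rightarrow> nat \<Rightarrow> bool" where
  "Fq_subspace_of_dim q U r \<longleftrightarrow>
     (\<exists>B. finite B \<and> card B = r \<and> Fq_independent q B \<and> Fq_span q B = U)"

text \<open>A point of the projective line is the one-dimensional \<open>'a\<close>-subspace of \<open>'a ^ 2\<close> that it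
  stands for.\<close>

definition linear_set :: "('a::field ^ 2) set \<Rightarrow> ('a ^ 2) set set" where
  "linear_set U = {vec.span {u} | u. u \<in> U \<and> u \<noteq> 0}"

text \<open>Rank is an attribute of the subspace \<open>U\<close> and not of the point set, hence the argument \<open>U\<close>.\<close>

definition scattered_of_rank :: "nat \<Rightarrow> ('a::field ^ 2) set \<Rightarrow> nat \<Rightarrow> bool" where
  "scattered_of_rank q U r \<longleftrightarrow>
     Fq_subspace_of_dim q U r \<and> card (linear_set U) = (q ^ r - 1) div (q - 1)"

definition maximum_scattered :: "nat \<Rightarrow> ('a::field ^ 2) set \<Rightarrow> bool" where
  "maximum_scattered q U \<longleftrightarrow> scattered_of_rank q U 5"

definition field_automorphism :: "('a::field \<Rightarrow> 'a) \<Rightarrow> bool" where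
  "field_automorphism \<sigma> \<longleftrightarrow>
     bij \<sigma> \<and> (\<forall>x y. \<sigma> (x + y) = \<sigma> x + \<sigma> y) \<and> (\<forall>x y. \<sigma> (x * y) = \<sigma> x * \<sigma> y)"

definition semilinear_map :: "'a::field ^ 2 ^ 2 \<Rightarrow> ('a \<Rightarrow> 'a) \<Rightarrow> 'a ^ 2 \<Rightarrow> 'a ^ 2" where
  "semilinear_map A \<sigma> v = A *v (\<chi> i. \<sigma> (v $ i))"

text \<open>A collineation maps a point, which is a set of vectors, to its image under an invertible
  semilinear map.\<close>

definition PGammaL :: "(('a::field ^ 2) set \<Rightarrow> ('a ^ 2) set) set" where
  "PGammaL = {(\<lambda>P. semilinear_map A \<sigma> ` P) | A \<sigma>. invertible A \<and> field_automorphism \<sigma>}"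

definition PGammaL_equivalent :: "('a::field ^ 2) set set \<Rightarrow> ('a ^ 2) set set \<Rightarrow> bool" where
  "PGammaL_equivalent L L' \<longleftrightarrow> (\<exists>\<phi>\<in>PGammaL. \<phi> ` L = L')"

definition U_ab :: "nat \<Rightarrow> 'a::field \<Rightarrow> 'a \<Rightarrow> ('a ^ 2) set" where
  "U_ab q \<alpha> \<beta> = range (\<lambda>x. vector [x - \<alpha> * x ^ (q ^ 2), x ^ q - \<beta> * x ^ (q ^ 2)])"

text \<open>\<open>\<alpha> ^ q \<noteq> \<beta> ^ (q + 1)\<close> makes the parametrisation of \<open>U_ab q \<alpha> \<beta>\<close> injective, so that its nonzero
  vectors are those with \<open>x \<noteq> 0\<close>.\<close>

definition L_ab :: "nat \<Rightarrow> 'a::field \<Rightarrow> 'a \<Rightarrow> ('a ^ 2) set set" where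
  "L_ab q \<alpha> \<beta> = linear_set (U_ab q \<alpha> \<beta>)"

definition L1 :: "nat \<Rightarrow> 'a::field \<Rightarrow> ('a ^ 2) set set" where
  "L1 q \<eta> = {vec.span {vector [x, \<eta> * x ^ q + x ^ (q ^ 4)]} | x. x \<noteq> 0}"

end

theory Submission
  imports Defs "HOL-Combinatorics.Cycles"
begin

text \<open>
  The linear set of the graph of a \<open>q\<close>-polynomial \<open>g x = (\<Sum>i<5. c i * x ^ (q ^ i))\<close> is determined by
  its set of slopes \<open>g x / x\<close>, and it determines in turn all power sums of the slopes.  The exponents
  \<open>\<Sum>j\<in>J. q ^ j\<close> with \<open>J \<subseteq> {..<5}\<close> are the useful ones: by orthogonality of characters
  (\<open>sum_frob_character\<close>) the power sum then is, up to sign, a permanent in the Frobenius conjugates of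
  the coefficients.  The arithmetic behind this is that a sum of at most \<open>card J\<close> powers of \<open>q\<close> is
  congruent to \<open>\<Sum>j\<in>J. q ^ j\<close> modulo \<open>q ^ 5 - 1\<close> only in the obvious way
  (\<open>powers_cong_imp_eq\<close>).  Comparing such power sums for a graph whose linear set is \<open>L1 q \<eta>\<close>
  shows that \<open>g x = c 1 * x ^ q + c 4 * x ^ (q ^ 4)\<close>, with \<open>c 1 * c 4 ^ q = \<eta>\<close> and with
  \<open>N (c 1) + N (c 4) = N \<eta> + 1\<close> for the norm \<open>N\<close> (\<open>coeffs_if_slopes_eq_LP\<close>).

  Suppose now that a collineation maps \<open>L_ab q \<alpha> \<beta>\<close> to \<open>L1 q \<eta>\<close>.  Up to a field automorphism applied
  to \<open>\<alpha>\<close> and \<open>\<beta>\<close>, which affects neither \<open>\<beta> = 0\<close> nor \<open>N \<alpha> = - 1\<close>, it is linear, and it sends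
  \<open>U_ab q \<alpha> \<beta>\<close> to the graph of such a \<open>g\<close>.  Both coordinates of the image are \<open>q\<close>-polynomials in \<open>x\<close>
  without terms in \<open>x ^ (q ^ 3)\<close> and \<open>x ^ (q ^ 4)\<close>, and \<open>g\<close> shifts the degrees of the first coordinate
  cyclically by one in both directions.  This leaves room for a single term in the first coordinate,
  which forces \<open>\<beta> = 0\<close>, and gives \<open>N \<alpha> = - N (c 1) / N (c 4)\<close>.  By their product and sum,
  \<open>N (c 1)\<close> and \<open>N (c 4)\<close> are \<open>1\<close> and \<open>N \<eta>\<close> in some order; they differ because \<open>N \<eta> \<noteq> 1\<close>, whence
  \<open>N \<alpha> \<noteq> - 1\<close> (\<open>linear_image_eq_L1_imp\<close>).  Conversely, for \<open>\<beta> = 0\<close> a swap of the coordinates shows that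
  \<open>L_ab q \<alpha> 0\<close> is \<open>L1 q (- \<alpha>)\<close>, up to a collineation.
\<close>

section \<open>Sums of powers of \<open>q\<close> modulo \<open>q ^ n - 1\<close>\<close>

text \<open>
  Uniqueness of base-\<open>q\<close> expansions, by reading off the lowest digit modulo \<open>q\<close>.
\<close>

lemma digits_unique:
  fixes c d :: "nat \<Rightarrow> nat"
  assumes "(\<Sum>i<n. c i * q ^ i) = (\<Sum>i<n. d i * q ^ i)"
    and "\<And>i. c i < q" and "\<And>i. d i < q" and "i < n"
  shows "c i = d i"
  using assms
proof (induction n arbitrary: c d i)
  case (Suc n)
  have split: "(\<Sum>i<Suc n. e i * q ^ i) = e 0 + q * (\<Sum>i<n. e (Suc i) * q ^ i)" for e :: "nat \<Rightarrow> nat"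
    by (subst sum.lessThan_Suc_shift) (simp add: sum_distrib_left mult_ac)
  have eq: "c 0 + q * (\<Sum>i<n. c (Suc i) * q ^ i) = d 0 + q * (\<Sum>i<n. d (Suc i) * q ^ i)"
    using Suc.prems(1) unfolding split .
  have q: "q > 0" using Suc.prems(2)[of 0] by simp
  have "(c 0 + q * (\<Sum>i<n. c (Suc i) * q ^ i)) mod q = c 0"
    using Suc.prems(2)[of 0] by simp
  moreover have "(d 0 + q * (\<Sum>i<n. d (Suc i) * q ^ i)) mod q = d 0"
    using Suc.prems(3)[of 0] by simp
  ultimately have c0: "c 0 = d 0" using eq by simp
  hence rest: "(\<Sum>i<n. c (Suc i) * q ^ i) = (\<Sum>i<n. d (Suc i) * q ^ i)"
    using eq q by simp
  show ?case
  proof (cases i)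
    case (Suc k)
    with Suc.IH[of "\<lambda>i. c (Suc i)" "\<lambda>i. d (Suc i)" k] rest Suc.prems show ?thesis by simp
  qed (simp add: c0)
qed simp

lemma digits_less:
  fixes c :: "nat \<Rightarrow> nat"
  assumes "\<And>i. c i < q"
  shows "(\<Sum>i<n. c i * q ^ i) < q ^ n"
proof (induction n)
  case (Suc n)
  have "(\<Sum>i<Suc n. c i * q ^ i) < q ^ n + c n * q ^ n" using Suc by simp
  also have "\<dots> = (c n + 1) * q ^ n" by simp
  also have "\<dots> \<le> q * q ^ n" by (rule mult_right_mono) (use assms[of n] in auto)
  finally show ?case by simp
qed simp

lemma sum_mset_conv_digits:
  fixes M :: "nat multiset"
  assumes "set_mset M \<subseteq> {..<n}"
  shows "(\<Sum>i\<in>#M. q ^ i) = (\<Sum>i<n. count M i * q ^ i)"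
  using assms
proof (induction M)
  case (add x M)
  have "(\<Sum>i<n. count (add_mset x M) i * q ^ i)
      = (\<Sum>i<n. count M i * q ^ i + (if i = x then q ^ x else 0))"
    by (intro sum.cong) auto
  with add show ?case by (simp add: sum.distrib)
qed simp

text \<open>
  Modulo \<open>q ^ n - 1\<close> the powers \<open>q ^ i\<close> are indexed cyclically, and \<open>q\<close> equal ones merge into one
  copy of the next by a carry.  If some exponent occurs at least \<open>q\<close> times in \<open>M\<close>, a carry
  produces a strictly smaller multiset with the same residue; by induction that one is \<open>J\<close>, which
  contradicts \<open>size M \<le> card J\<close>.  If no carry is possible, both sums are base-\<open>q\<close>
  expansions of numbers between \<open>1\<close> and \<open>q ^ n - 1\<close>, so congruence means equality and the digits
  agree.  The multiset has to be nonempty: for \<open>q = 2\<close> the full set \<open>J = {..<n}\<close> has sum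
  \<open>q ^ n - 1\<close>, with the residue of the empty sum.
\<close>

lemma powers_cong_imp_eq:
  fixes M :: "nat multiset" and q n :: nat
  assumes "q \<ge> 2" "n > 0" and J: "J \<subseteq> {..<n}" "J \<noteq> {}"
    and "set_mset M \<subseteq> {..<n}" "M \<noteq> {#}" "size M \<le> card J"
    and "[(\<Sum>i\<in>#M. q ^ i) = (\<Sum>j\<in>J. q ^ j)] (mod (q ^ n - 1))"
  shows "M = mset_set J"
  using assms(5-)
proof (induction "size M" arbitrary: M rule: less_induct)
  case less
  have finJ: "finite J" using J finite_subset by blast
  show ?case
  proof (cases "\<exists>i. count M i \<ge> q")
    case True
    then obtain i where i: "count M i \<ge> q" by blast
    define R where "R = M - replicate_mset q i"
    have M: "M = R + replicate_mset q i"
      unfolding R_def using i by (simp add: count_le_replicate_mset_subset_eq)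
    have "i \<in># M" using i assms(1) by (metis count_greater_zero_iff le_zero_eq not_gr_zero zero_neq_numeral)
    hence "i < n" using less.prems(1) by auto
    \<comment> \<open>the carry, which wraps around because \<open>q ^ n\<close> is \<open>1\<close> modulo \<open>q ^ n - 1\<close>\<close>
    define M' where "M' = add_mset ((i + 1) mod n) R"
    have "[q * q ^ i = q ^ ((i + 1) mod n)] (mod (q ^ n - 1))"
    proof (cases "i + 1 = n")
      case True
      have "q ^ n \<ge> 1" using assms(1) by simp
      hence "[q ^ n = 1] (mod (q ^ n - 1))" by (simp add: cong_altdef_nat)
      thus ?thesis using True by (metis One_nat_def Suc_eq_plus1 mod_self power_0 power_Suc)
    next
      case False
      thus ?thesis using \<open>i < n\<close> by simp
    qed
    hence "[(\<Sum>i\<in>#M'. q ^ i) = (\<Sum>i\<in>#M. q ^ i)] (mod (q ^ n - 1))"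
      unfolding M M'_def 
      by (simp add: add.commute[of _ "sum_mset _"] cong_add_lcancel_nat cong_sym_eq)
    hence cong: "[(\<Sum>i\<in>#M'. q ^ i) = (\<Sum>j\<in>J. q ^ j)] (mod (q ^ n - 1))"
      using less.prems(4) cong_trans by blast
    have size: "size M' < size M" unfolding M M'_def using assms(1) by simp
    have "set_mset M' \<subseteq> {..<n}"
      using less.prems(1) assms(2) unfolding M M'_def by auto
    hence "M' = mset_set J"
      using less.hyps[OF size] cong size less.prems(3) unfolding M'_def by auto
    hence "size M' = card J" by simp
    with size less.prems(3) show ?thesis by simp
  next
    case False
    define N where "N = mset_set J"
    have N: "set_mset N \<subseteq> {..<n}" "N \<noteq> {#}" "(\<Sum>j\<in>J. q ^ j) = (\<Sum>i\<in>#N. q ^ i)"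
      using J finJ by (auto simp: N_def mset_set_empty_iff sum_unfold_sum_mset)
    have cM: "count M i < q" for i using False by (meson not_le)
    have cN: "count N i < q" for i
      using assms(1) by (cases "i \<in> J") (auto simp: N_def finJ)
    have pos: "(\<Sum>i\<in>#K. q ^ i) > 0" if "K \<noteq> {#}" for K :: "nat multiset"
      using that assms(1) by (cases K) auto
    have bound: "(\<Sum>i\<in>#M. q ^ i) < q ^ n" "(\<Sum>i\<in>#N. q ^ i) < q ^ n"
      using sum_mset_conv_digits[OF less.prems(1), of q] sum_mset_conv_digits[OF N(1), of q]
        digits_less[of "count M" q n] digits_less[of "count N" q n] cM cN by auto
    \<comment> \<open>shifting by one turns the range \<open>{1..m}\<close> into the least residues modulo \<open>m\<close>\<close>
    have un: "a = b" if "[a = b] (mod m)" "0 < a" "a \<le> m" "0 < b" "b \<le> m" for a b m :: nat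
    proof -
      have "[a - 1 + 1 = b - 1 + 1] (mod m)" using that by simp
      hence "[a - 1 = b - 1] (mod m)" by (simp only: cong_add_rcancel_nat)
      hence "a - 1 = b - 1" by (rule cong_less_modulus_unique_nat) (use that in auto)
      with that show ?thesis by simp
    qed
    have "(\<Sum>i\<in>#M. q ^ i) = (\<Sum>i\<in>#N. q ^ i)"
      by (rule un[of _ _ "q ^ n - 1"])
        (use less.prems(2,4) N pos bound in \<open>auto simp: less_eq_Suc_le\<close>)
    hence "(\<Sum>i<n. count M i * q ^ i) = (\<Sum>i<n. count N i * q ^ i)"
      using sum_mset_conv_digits less.prems(1) N(1) by simp
    hence *: "count M i = count N i" if "i < n" for i
      using digits_unique[of "count M" q n "count N" i] cM cN that by blast
    have "count M i = count N i" for i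
    proof (cases "i < n")
      case False
      hence "i \<notin># M" "i \<notin># N" using less.prems(1) N(1) by auto
      thus ?thesis by (simp add: not_in_iff)
    qed (rule *)
    thus ?thesis unfolding N_def by (intro multiset_eqI)
  qed
qed

section \<open>Frobenius maps and character sums in the field of order \<open>q ^ 5\<close>\<close>

lemma norm5_expand: "norm5 q x = x * x ^ q * x ^ (q ^ 2) * x ^ (q ^ 3) * x ^ (q ^ 4)"
  by (simp add: norm5_def eval_nat_numeral)

lemma norm5_mult: "norm5 q (x * y) = norm5 q x * norm5 q y"
  by (simp add: norm5_def power_mult_distrib prod.distrib)

locale quintic =
  fixes q :: nat and ty :: "'a :: {field, finite} itself"
  assumes primepow_q: "primepow q" and card_field: "CARD('a) = q ^ 5"
begin

lemma q_ge_2: "q \<ge> 2"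
  using primepow_gt_Suc_0[OF primepow_q] by simp

lemma prime_char: "prime CHAR('a)" "\<exists>m. q = CHAR('a) ^ m"
proof -
  obtain p k where pk: "prime p" "q = p ^ k" using primepow_q by (auto simp: primepow_def)
  show pr: "prime CHAR('a)"
    by (rule prime_CHAR_semidom) (rule finite_imp_CHAR_pos, simp)
  have "CHAR('a) dvd q ^ 5" using CHAR_dvd_CARD[where ?'a = 'a] card_field by simp
  hence "CHAR('a) dvd p" using pr pk by (metis prime_dvd_power)
  hence "CHAR('a) = p" using pr pk by (simp add: primes_dvd_imp_eq)
  thus "\<exists>m. q = CHAR('a) ^ m" using pk by blast
qed

lemma frob_pow: "\<exists>m. q ^ i = CHAR('a) ^ m"
  using prime_char(2) by (metis power_mult)

lemma frob_add: "(x + y :: 'a) ^ (q ^ i) = x ^ (q ^ i) + y ^ (q ^ i)"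
  using frob_pow[of i] prime_char(1) freshmans_dream' by blast

lemma frob_sum: "(\<Sum>k\<in>A. f k :: 'a) ^ (q ^ i) = (\<Sum>k\<in>A. f k ^ (q ^ i))"
  using frob_pow[of i] prime_char(1) freshmans_dream_sum' by blast

lemma frob_minus: "(- x :: 'a) ^ (q ^ i) = - (x ^ (q ^ i))"
proof -
  have "x ^ (q ^ i) + (- x) ^ (q ^ i) = 0"
    using frob_add[of x "- x" i] q_ge_2 by (simp add: power_0_left)
  thus ?thesis by (simp add: eq_neg_iff_add_eq_0 add.commute)
qed

lemma power_card_minus_1: "x \<noteq> 0 \<Longrightarrow> (x :: 'a) ^ (q ^ 5 - 1) = 1"
proof -
  assume x: "x \<noteq> 0"
  have "\<Prod>(-{0}) = (\<Prod>y\<in>-{0}. x * y)"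
    by (rule prod.reindex_bij_witness[of _ "\<lambda>y. x * y" "\<lambda>y. y / x"]) (use x in auto)
  also have "\<dots> = x ^ (q ^ 5 - 1) * \<Prod>(-{0})"
    by (simp add: prod.distrib Compl_eq_Diff_UNIV card_Diff_singleton card_field)
  finally show ?thesis by simp
qed

lemma power_card: "(x :: 'a) ^ (q ^ 5) = x"
proof (cases "x = 0")
  case False
  have "x ^ (q ^ 5) = x ^ (q ^ 5 - 1) * x"
    using q_ge_2 by (metis One_nat_def Suc_pred card_field mult.commute power_Suc zero_less_card_finite)
  thus ?thesis using power_card_minus_1[OF False] by simp
qed (use q_ge_2 in simp)

lemma frob_frob: "((x :: 'a) ^ (q ^ i)) ^ (q ^ j) = x ^ (q ^ ((i + j) mod 5))"
proof -
  have *: "(x :: 'a) ^ (q ^ (5 * k)) = x" for k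
  proof (induction k)
    case (Suc k)
    have "x ^ (q ^ (5 * Suc k)) = (x ^ (q ^ 5)) ^ (q ^ (5 * k))"
      by (simp add: power_add flip: power_mult)
    with Suc show ?case by (simp only: power_card)
  qed simp
  have "(x ^ (q ^ i)) ^ (q ^ j) = x ^ (q ^ (i + j))"
    by (simp only: power_add power_mult)
  also have "\<dots> = x ^ (q ^ (5 * ((i + j) div 5) + (i + j) mod 5))"
    by simp
  also have "\<dots> = (x ^ (q ^ (5 * ((i + j) div 5)))) ^ (q ^ ((i + j) mod 5))"
    by (simp only: power_add power_mult)
  finally show ?thesis by (simp only: *)
qed

lemma sum_nonzero_1: "(\<Sum>x\<in>-{0 :: 'a}. 1) = (- 1 :: 'a)"
proof -
  have "CARD('a) > 0" by simp
  hence "(of_nat (CARD('a) - 1) :: 'a) = of_nat (CARD('a)) - 1"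
    by (subst of_nat_diff) auto
  also have "(of_nat (CARD('a)) :: 'a) = 0"
    using CHAR_dvd_CARD of_nat_eq_0_iff_char_dvd by blast
  finally show ?thesis by (simp add: Compl_eq_Diff_UNIV card_Diff_singleton)
qed

text \<open>
  Orthogonality of multiplicative characters.  If \<open>a\<close> and \<open>b\<close> differ modulo \<open>q ^ 5 - 1\<close>, some \<open>y\<close>
  has \<open>y ^ a \<noteq> y ^ b\<close>, because a nonzero polynomial of degree less than \<open>q ^ 5 - 1\<close> cannot vanish
  on all nonzero elements; the substitution \<open>x \<mapsto> y * x\<close> then multiplies the sum by a factor
  other than \<open>1\<close>.
\<close>

lemma sum_character:
  "(\<Sum>x\<in>-{0 :: 'a}. x ^ a / x ^ b) = (if [a = b] (mod (q ^ 5 - 1)) then - 1 else 0)"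
proof -
  define n where "n = q ^ 5 - 1"
  have "q ^ 5 > 1" using q_ge_2 by (intro one_less_power) auto
  hence n: "n > 0" by (simp add: n_def)
  have red: "x ^ k = x ^ (k mod n)" if "x \<noteq> 0" for x :: 'a and k
  proof -
    have "x ^ k = (x ^ n) ^ (k div n) * x ^ (k mod n)"
      by (simp flip: power_mult power_add)
    thus ?thesis using power_card_minus_1[OF that] by (simp add: n_def)
  qed
  show ?thesis
  proof (cases "[a = b] (mod n)")
    case True
    hence "(\<Sum>x\<in>-{0 :: 'a}. x ^ a / x ^ b) = (\<Sum>x\<in>-{0 :: 'a}. 1)"
      by (intro sum.cong refl) (metis red cong_def divide_self power_not_zero ComplD singletonI)
    thus ?thesis using True sum_nonzero_1 by (simp add: n_def)
  next
    case False
    define P :: "'a poly" where "P = Polynomial.monom 1 (a mod n) - Polynomial.monom 1 (b mod n)"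
    have neq: "a mod n \<noteq> b mod n" using False by (simp add: cong_def)
    hence "Polynomial.coeff P (a mod n) = 1" by (simp add: P_def)
    hence "P \<noteq> 0" by auto
    have "degree P < n" unfolding P_def
      by (intro degree_diff_less) (use n in \<open>simp_all add: degree_monom_eq\<close>)
    have "\<exists>y\<in>-{0 :: 'a}. poly P y \<noteq> 0"
    proof (rule ccontr)
      assume "\<not> ?thesis"
      hence "-{0} \<subseteq> {x. poly P x = 0}" by blast
      hence "card (-{0 :: 'a}) \<le> card {x. poly P x = 0}" by (intro card_mono) auto
      also have "\<dots> \<le> n - 1" using card_poly_roots_bound[OF \<open>P \<noteq> 0\<close>] \<open>degree P < n\<close> by simp
      finally show False using n by (simp add: Compl_eq_Diff_UNIV card_Diff_singleton card_field n_def)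
    qed
    then obtain y where y: "y \<noteq> 0" "poly P y \<noteq> 0" by auto
    hence y_ne: "y ^ a \<noteq> y ^ b" using red[OF y(1)] by (simp add: P_def poly_monom)
    have "(\<Sum>x\<in>-{0 :: 'a}. x ^ a / x ^ b) = (\<Sum>x\<in>-{0 :: 'a}. (y * x) ^ a / (y * x) ^ b)"
      by (rule sum.reindex_bij_witness[of _ "\<lambda>x. y * x" "\<lambda>x. x / y"]) (use y in auto)
    also have "\<dots> = y ^ a / y ^ b * (\<Sum>x\<in>-{0 :: 'a}. x ^ a / x ^ b)"
      by (simp add: power_mult_distrib sum_distrib_left)
    finally have "(\<Sum>x\<in>-{0 :: 'a}. x ^ a / x ^ b) = 0 \<or> y ^ a / y ^ b = 1"
      by (metis mult_cancel_right1)
    thus ?thesis using y_ne False y(1) by (simp add: n_def)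
  qed
qed

text \<open>
  The form of character orthogonality that the power sums need: a product of Frobenius powers of
  \<open>x\<close> matches the denominator only if the exponents in \<open>l\<close> are a permutation of \<open>J\<close>.  As
  \<open>length l = card J\<close>, this is expressed by \<open>J \<subseteq> set l\<close>, which is easy to decide for explicit lists.
\<close>

lemma sum_frob_character:
  assumes J: "J \<subseteq> {..<5}" "J \<noteq> {}" and l: "set l \<subseteq> {..<5}" "length l = card J"
  shows "(\<Sum>x\<in>-{0 :: 'a}. (\<Prod>i\<leftarrow>l. x ^ (q ^ i)) / (\<Prod>j\<in>J. x ^ (q ^ j)))
       = (if J \<subseteq> set l then - 1 else 0)"
proof -
  have finJ: "finite J" using J finite_subset by blast
  hence "card J \<noteq> 0" using J by auto
  hence "l \<noteq> []" using l by auto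
  have num: "(\<Prod>i\<leftarrow>l. x ^ (q ^ i)) = x ^ (\<Sum>i\<in>#mset l. q ^ i)" for x :: 'a
    by (induction l) (simp_all add: power_add)
  have "[(\<Sum>i\<in>#mset l. q ^ i) = (\<Sum>j\<in>J. q ^ j)] (mod (q ^ 5 - 1)) \<longleftrightarrow> J \<subseteq> set l"
  proof
    assume "[(\<Sum>i\<in>#mset l. q ^ i) = (\<Sum>j\<in>J. q ^ j)] (mod (q ^ 5 - 1))"
    hence "mset l = mset_set J"
      by (intro powers_cong_imp_eq[of q 5]) (use q_ge_2 J l \<open>l \<noteq> []\<close> in auto)
    thus "J \<subseteq> set l" using finJ by (metis finite_set_mset_mset_set set_mset_mset subset_refl)
  next
    assume sub: "J \<subseteq> set l"
    have "card (set l) \<le> card J" using l card_length by metis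
    hence "J = set l" using sub by (intro card_seteq) auto
    moreover from this have "distinct l" using l by (simp add: card_distinct)
    ultimately have "(\<Sum>i\<in>#mset l. q ^ i) = (\<Sum>j\<in>J. q ^ j)"
      by (simp add: sum_unfold_sum_mset mset_set_set)
    thus "[(\<Sum>i\<in>#mset l. q ^ i) = (\<Sum>j\<in>J. q ^ j)] (mod (q ^ 5 - 1))" by simp
  qed
  moreover have den: "(\<Prod>j\<in>J. x ^ (q ^ j)) = x ^ (\<Sum>j\<in>J. q ^ j)" for x :: 'a
    by (simp add: power_sum)
  ultimately show ?thesis unfolding num den sum_character by simp
qed

lemma norm5_minus: "norm5 q (- x :: 'a) = - norm5 q x"
  using frob_minus[of x 0] frob_minus[of x 1] by (simp add: norm5_expand frob_minus)

lemma norm5_frob: "norm5 q ((x :: 'a) ^ (q ^ i)) = norm5 q x"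
proof (induction i)
  case (Suc i)
  have step: "norm5 q (y ^ q) = norm5 q y" for y :: 'a
    using frob_frob[of y 1 1] frob_frob[of y 1 2] frob_frob[of y 1 3] frob_frob[of y 1 4]
    by (simp add: norm5_expand power2_eq_square mult_ac)
  have "x ^ (q ^ Suc i) = (x ^ (q ^ i)) ^ q"
    by (simp add: mult.commute flip: power_mult)
  with Suc step show ?case by simp
qed simp

lemma norm5_eq_0_iff: "norm5 q (x :: 'a) = 0 \<longleftrightarrow> x = 0"
  using q_ge_2 by (auto simp: norm5_expand)

end

section \<open>Power sums of the slopes of a \<open>q\<close>-polynomial\<close>

lemma sum_lessThan_5: "(\<Sum>i<5. f i) = f 0 + f 1 + f 2 + f 3 + f (4 :: nat)"
  by (simp add: eval_nat_numeral)

text \<open>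
  Translation by \<open>k\<close> permutes \<open>K\<close>, hence leaves the sum over \<open>K\<close> unchanged, and it adds
  \<open>card K * k\<close> to it.
\<close>

lemma card_additive_subgroup:
  fixes K :: "'a :: {field, finite} set"
  assumes "\<And>x y. x \<in> K \<Longrightarrow> y \<in> K \<Longrightarrow> x + y \<in> K" "k \<in> K" "k \<noteq> 0"
  shows "(of_nat (card K) :: 'a) = 0"
proof -
  have "(\<lambda>x. x + k) ` K = K"
    by (rule card_subset_eq) (use assms in \<open>auto simp: card_image\<close>)
  hence "\<Sum>K = (\<Sum>x\<in>K. x + k)"
    using sum.reindex[of "\<lambda>x. x + k" K "\<lambda>x. x"] by (simp add: o_def)
  hence "of_nat (card K) * k = 0" by (simp add: sum.distrib)
  thus ?thesis using assms(3) by simp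
qed

context quintic
begin

definition qpoly :: "(nat \<Rightarrow> 'a) \<Rightarrow> 'a \<Rightarrow> 'a" where
  "qpoly c x = (\<Sum>i<5. c i * x ^ (q ^ i))"

text \<open>
  The coefficients of \<open>qpoly c x ^ (q ^ j)\<close> as a \<open>q\<close>-polynomial again; in other words row \<open>j\<close> of the
  Dickson matrix of \<open>c\<close>.  The summand \<open>5\<close> keeps the subtraction in the natural numbers.
\<close>

definition twist :: "(nat \<Rightarrow> 'a) \<Rightarrow> nat \<Rightarrow> nat \<Rightarrow> 'a" where
  "twist c j i = c ((i + 5 - j) mod 5) ^ (q ^ j)"

lemma qpoly_frob:
  assumes "j < 5"
  shows "qpoly c x ^ (q ^ j) = qpoly (twist c j) x"
proof -
  have "qpoly c x ^ (q ^ j) = (\<Sum>i<5. c i ^ (q ^ j) * x ^ (q ^ ((i + j) mod 5)))"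
    by (simp add: qpoly_def frob_sum power_mult_distrib frob_frob)
  also have "\<dots> = (\<Sum>i<5. twist c j i * x ^ (q ^ i))"
    unfolding twist_def
  proof (rule sum.reindex_bij_witness[of _ "\<lambda>i. (i + 5 - j) mod 5" "\<lambda>i. (i + j) mod 5"])
    fix i assume "i \<in> {..<(5 :: nat)}"
    with assms show *: "((i + j) mod 5 + 5 - j) mod 5 = i" and "((i + 5 - j) mod 5 + j) mod 5 = i"
      by (auto simp: mod_if)
    show "c (((i + j) mod 5 + 5 - j) mod 5) ^ (q ^ j) * x ^ (q ^ ((i + j) mod 5))
        = c i ^ (q ^ j) * x ^ (q ^ ((i + j) mod 5))" unfolding * ..
  qed auto
  finally show ?thesis by (simp add: qpoly_def)
qed

lemma qpoly_add: "qpoly c (x + y) = qpoly c x + qpoly c y"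
  by (simp add: qpoly_def frob_add algebra_simps sum.distrib)

lemma qpoly_comp: "\<exists>e. \<forall>x. qpoly c (qpoly d x) = qpoly e x"
proof (intro exI allI)
  fix x
  have "qpoly c (qpoly d x) = (\<Sum>i<5. c i * qpoly (twist d i) x)"
    unfolding qpoly_def[of c] by (intro sum.cong refl) (simp add: qpoly_frob)
  also have "\<dots> = (\<Sum>i<5. \<Sum>k<5. c i * twist d i k * x ^ (q ^ k))"
    by (simp add: qpoly_def sum_distrib_left mult.assoc)
  also have "\<dots> = (\<Sum>k<5. \<Sum>i<5. c i * twist d i k * x ^ (q ^ k))"
    by (rule sum.swap)
  also have "\<dots> = qpoly (\<lambda>k. \<Sum>i<5. c i * twist d i k) x"
    by (simp add: qpoly_def sum_distrib_right)
  finally show "qpoly c (qpoly d x) = qpoly (\<lambda>k. \<Sum>i<5. c i * twist d i k) x" .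
qed

text \<open>
  A permutation of a finite set has finite order, so its inverse is one of its iterates, and
  \<open>q\<close>-polynomials are closed under composition.
\<close>

lemma qpoly_inverse:
  assumes "inj (qpoly c)"
  shows "\<exists>d. \<forall>x. qpoly d (qpoly c x) = x"
proof -
  have "permutation (qpoly c)"
    using assms finite_UNIV_inj_surj[of "qpoly c"] by (auto simp: permutation bij_def)
  then obtain n where n: "qpoly c ^^ n = id" "n > 0"
    using permutation_is_nilpotent by blast
  have "\<exists>d. \<forall>x. (qpoly c ^^ m) x = qpoly d x" for m
  proof (induction m)
    case 0
    have "qpoly (\<lambda>i. if i = 0 then 1 else 0) x = x" for x
      by (simp add: qpoly_def if_distrib[of "\<lambda>z. z * _"] cong: if_cong)
    thus ?case by (metis funpow_0)
  next
    case (Suc m)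
    then obtain d where "\<forall>x. (qpoly c ^^ m) x = qpoly d x" by blast
    moreover obtain e where "\<forall>x. qpoly c (qpoly d x) = qpoly e x" using qpoly_comp by blast
    ultimately show ?case by auto
  qed
  then obtain d where d: "\<forall>x. (qpoly c ^^ (n - 1)) x = qpoly d x" by blast
  have "qpoly d (qpoly c x) = x" for x
  proof -
    have "qpoly d (qpoly c x) = (qpoly c ^^ Suc (n - 1)) x"
      using d by (simp add: funpow_Suc_right del: funpow.simps)
    thus ?thesis using n by simp
  qed
  thus ?thesis by blast
qed

text \<open>
  For \<open>J = set js\<close> and \<open>l = []\<close> this is the power sum of \<open>qpoly c x / x\<close> with exponent
  \<open>\<Sum>j\<in>J. q ^ j\<close>.  The accumulator \<open>l\<close> records which Frobenius powers of \<open>x\<close> have been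
  selected while the factors \<open>qpoly c x ^ (q ^ j)\<close> are expanded one after the other.  A full
  expansion shows that the power sum is minus the permanent of the principal submatrix of the
  Dickson matrix with index set \<open>J\<close>.
\<close>

definition psum :: "nat set \<Rightarrow> (nat \<Rightarrow> 'a) \<Rightarrow> nat list \<Rightarrow> nat list \<Rightarrow> 'a" where
  "psum J c js l = (\<Sum>x\<in>-{0}.
     (\<Prod>j\<leftarrow>js. qpoly c x ^ (q ^ j)) * (\<Prod>i\<leftarrow>l. x ^ (q ^ i)) / (\<Prod>j\<in>J. x ^ (q ^ j)))"

lemma psum_Nil:
  assumes "J \<subseteq> {..<5}" "J \<noteq> {}" "set l \<subseteq> {..<5}" "length l = card J"
  shows "psum J c [] l = (if J \<subseteq> set l then - 1 else 0)"
  using sum_frob_character[OF assms] by (simp add: psum_def)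

lemma psum_Cons:
  assumes "j < 5"
  shows "psum J c (j # js) l = (\<Sum>i<5. twist c j i * psum J c js (i # l))"
proof -
  define R where "R x = (\<Prod>j\<leftarrow>js. qpoly c x ^ (q ^ j)) * (\<Prod>i\<leftarrow>l. x ^ (q ^ i)) / (\<Prod>j\<in>J. x ^ (q ^ j))" for x
  have "psum J c (j # js) l = (\<Sum>x\<in>-{0}. \<Sum>i<5. twist c j i * (x ^ (q ^ i) * R x))"
    unfolding psum_def
  proof (intro sum.cong refl)
    fix x
    have "(\<Prod>j\<leftarrow>j # js. qpoly c x ^ (q ^ j)) * (\<Prod>i\<leftarrow>l. x ^ (q ^ i)) / (\<Prod>j\<in>J. x ^ (q ^ j))
        = qpoly (twist c j) x * R x"
      by (simp add: R_def qpoly_frob[OF assms] mult.assoc)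
    thus "(\<Prod>j\<leftarrow>j # js. qpoly c x ^ (q ^ j)) * (\<Prod>i\<leftarrow>l. x ^ (q ^ i)) / (\<Prod>j\<in>J. x ^ (q ^ j))
        = (\<Sum>i<5. twist c j i * (x ^ (q ^ i) * R x))"
      by (simp add: qpoly_def sum_distrib_right mult.assoc)
  qed
  also have "\<dots> = (\<Sum>i<5. twist c j i * (\<Sum>x\<in>-{0}. x ^ (q ^ i) * R x))"
    by (subst sum.swap) (simp add: sum_distrib_left)
  finally show ?thesis by (simp add: psum_def R_def mult_ac)
qed

text \<open>
  The power sum with denominator \<open>x ^ (q ^ k)\<close> isolates the coefficient with index \<open>k\<close>.
\<close>

lemma qpoly_coeff:
  assumes "\<And>x. qpoly c x = qpoly d x" "k < 5"
  shows "c k = d k"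
proof -
  have *: "psum {k} e [0] [] = - e k" for e
  proof -
    have "psum {k} e [0] [] = (\<Sum>i<5. twist e 0 i * psum {k} e [] [i])"
      by (rule psum_Cons) simp
    also have "\<dots> = (\<Sum>i<5. if i = k then - e k else 0)"
      by (intro sum.cong refl) (use assms(2) in \<open>auto simp: psum_Nil twist_def\<close>)
    finally show ?thesis using assms(2) by simp
  qed
  have "psum {k} c [0] [] = psum {k} d [0] []"
    by (simp add: psum_def assms(1))
  thus ?thesis by (simp add: *)
qed

definition slopes :: "(nat \<Rightarrow> 'a) \<Rightarrow> 'a set" where
  "slopes c = (\<lambda>x. qpoly c x / x) ` (-{0})"

text \<open>
  The nonzero \<open>x\<close> with a given slope \<open>m\<close> form the kernel of the additive map
  \<open>x \<mapsto> qpoly c x - m * x\<close> without \<open>0\<close>.  The kernel has cardinality \<open>0\<close> in the field, so each slope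
  is counted with multiplicity \<open>- 1\<close>, whatever the weight of its point.
\<close>

lemma sum_over_slopes:
  fixes F :: "'a \<Rightarrow> 'a"
  shows "(\<Sum>x\<in>-{0}. F (qpoly c x / x)) = - (\<Sum>m\<in>slopes c. F m)"
proof -
  have fibre: "(of_nat (card {x \<in> -{0}. qpoly c x / x = m}) :: 'a) = - 1" if m: "m \<in> slopes c" for m
  proof -
    define K where "K = {x. qpoly c x = m * x}"
    have add: "x + y \<in> K" if "x \<in> K" "y \<in> K" for x y
      using that by (simp add: K_def qpoly_add algebra_simps)
    obtain k where "k \<noteq> 0" "m = qpoly c k / k" using m by (auto simp: slopes_def)
    hence k: "k \<in> K" "k \<noteq> 0" by (auto simp: K_def)
    have "0 \<in> K" using q_ge_2 by (simp add: K_def qpoly_def power_0_left)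
    moreover have "{x \<in> -{0}. qpoly c x / x = m} = K - {0}"
      by (auto simp: K_def field_simps)
    ultimately have "card K = Suc (card {x \<in> -{0}. qpoly c x / x = m})"
      by (metis card.remove finite_class.finite)
    thus ?thesis using card_additive_subgroup[OF add k]
      by (simp add: add_eq_0_iff add.commute)
  qed
  have "(\<Sum>x\<in>-{0}. F (qpoly c x / x))
      = (\<Sum>m\<in>slopes c. \<Sum>x\<in>{x \<in> -{0}. qpoly c x / x = m}. F (qpoly c x / x))"
    unfolding slopes_def by (rule sum.image_gen) simp
  also have "\<dots> = (\<Sum>m\<in>slopes c. of_nat (card {x \<in> -{0}. qpoly c x / x = m}) * F m)"
    by (intro sum.cong refl) simp
  also have "\<dots> = (\<Sum>m\<in>slopes c. - F m)"
    by (intro sum.cong refl) (simp only: fibre, simp)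
  finally show ?thesis by (simp add: sum_negf)
qed

text \<open>
  Power sums are invariants of the linear set and not only of the polynomial.
\<close>

lemma psum_cong_slopes:
  assumes "slopes c = slopes d" "distinct js"
  shows "psum (set js) c js [] = psum (set js) d js []"
proof -
  have *: "psum (set js) e js [] = - (\<Sum>m\<in>slopes e. \<Prod>j\<in>set js. m ^ (q ^ j))" for e
    using assms(2) sum_over_slopes[of "\<lambda>m. \<Prod>j\<in>set js. m ^ (q ^ j)" e]
    by (simp add: psum_def prod.distinct_set_conv_list power_divide prod_dividef)
  show ?thesis by (simp add: * assms(1))
qed

text \<open>
  Coefficients of the Lunardon-Polverino polynomial \<open>\<eta> * x ^ q + x ^ (q ^ 4)\<close> that defines
  \<open>L1 q \<eta>\<close>.
\<close>

definition LP :: "'a \<Rightarrow> nat \<Rightarrow> 'a" where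
  "LP \<eta> i = (if i = 1 then \<eta> else if i = 4 then 1 else 0)"

lemma psum_0: "psum {0} c [0] [] = - c 0"
  by (simp add: psum_Cons psum_Nil sum_lessThan_5 twist_def)

lemma psum_01: "psum {0,1} c [0,1] [] = - c 0 * c 0 ^ q - c 1 * c 4 ^ q"
  by (simp add: psum_Cons psum_Nil sum_lessThan_5 twist_def)

lemma psum_02: "psum {0,2} c [0,2] [] = - c 0 * c 0 ^ (q ^ 2) - c 2 * c 3 ^ (q ^ 2)"
  by (simp add: psum_Cons psum_Nil sum_lessThan_5 twist_def)

lemma psum_012:
  assumes "c 0 = 0"
  shows "psum {0,1,2} c [0,1,2] [] = - c 1 * c 1 ^ q * c 3 ^ (q ^ 2) - c 2 * c 4 ^ q * c 4 ^ (q ^ 2)"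
  using q_ge_2
  by (simp add: psum_Cons psum_Nil sum_lessThan_5 twist_def assms power_0_left algebra_simps)

text \<open>
  Only permutations of \<open>\<int>/5\<close> that move every index by \<open>1\<close> or \<open>-1\<close> contribute.  The number of
  indices is odd, so these are not built from transpositions of neighbours; the two rotations remain
  and give the two norms.
\<close>

lemma psum_norm:
  assumes "c 0 = 0" "c 2 = 0" "c 3 = 0"
  shows "psum {0,1,2,3,4} c [0,1,2,3,4] [] = - norm5 q (c 1) - norm5 q (c 4)"
proof -
  have q0: "(0 :: 'a) ^ (q ^ j) = 0" for j using q_ge_2 by simp
  have *: "psum J c (j # js) l = c 1 ^ (q ^ j) * psum J c js ((j + 1) mod 5 # l)
        + c 4 ^ (q ^ j) * psum J c js ((j + 4) mod 5 # l)" if "j < 5" for J j js l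
  proof -
    have "j \<in> {0,1,2,3,4}" using that by auto
    thus ?thesis
      by (elim insertE emptyE)
        (use q0[of 1] q_ge_2 in \<open>simp_all add: psum_Cons sum_lessThan_5 twist_def assms q0
          power_0_left add.commute flip: numeral_2_eq_2\<close>)
  qed
  show ?thesis by (simp add: * psum_Nil norm5_expand)
qed

text \<open>
  Recovers a \<open>q\<close>-polynomial, as far as possible, from its set of slopes.  The exponents \<open>1\<close>,
  \<open>1 + q\<close> and \<open>1 + q ^ 2\<close> give \<open>c 0\<close>, \<open>c 1 * c 4 ^ q\<close> and \<open>c 2 * c 3 ^ (q ^ 2)\<close>.  As the last of
  these is \<open>0\<close>, one of \<open>c 2\<close>, \<open>c 3\<close> vanishes, and the exponent \<open>1 + q + q ^ 2\<close> shows that then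
  both vanish.  The norm of the slope gives the final equation.
\<close>

lemma coeffs_if_slopes_eq_LP:
  assumes "slopes c = slopes (LP \<eta>)" "\<eta> \<noteq> 0"
  shows "c 0 = 0" "c 2 = 0" "c 3 = 0" "c 1 * c 4 ^ q = \<eta>"
    "norm5 q (c 1) + norm5 q (c 4) = norm5 q \<eta> + 1"
proof -
  have z: "(0 :: 'a) ^ q = 0" "(0 :: 'a) ^ (q ^ 2) = 0" using q_ge_2 by (simp_all add: power_0_left)
  note sums = psum_cong_slopes[OF assms(1)]
  show c0: "c 0 = 0"
    using sums[of "[0]"] by (simp add: psum_0 LP_def)
  show c14: "c 1 * c 4 ^ q = \<eta>"
    using sums[of "[0,1]"] psum_01 by (simp add: LP_def c0 z)
  have c23: "c 2 = 0 \<or> c 3 = 0"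
    using sums[of "[0,2]"] psum_02[of c] psum_02[of "LP \<eta>"] by (auto simp: LP_def c0 z)
  have "- c 1 * c 1 ^ q * c 3 ^ (q ^ 2) - c 2 * c 4 ^ q * c 4 ^ (q ^ 2) = 0"
    using sums[of "[0,1,2]"] psum_012[of c] psum_012[of "LP \<eta>"]
    by (simp add: LP_def c0 z)
  moreover have "c 1 \<noteq> 0" "c 4 \<noteq> 0" using c14 assms(2) z by auto
  ultimately show c2: "c 2 = 0" and c3: "c 3 = 0" using c23 q_ge_2 by (auto simp: power_0_left)
  have "- norm5 q (c 1) - norm5 q (c 4) = - norm5 q \<eta> - norm5 q (1 :: 'a)"
    using sums[of "[0,1,2,3,4]"] psum_norm[OF c0 c2 c3] psum_norm[of "LP \<eta>"] by (simp add: LP_def)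
  hence "- (norm5 q (c 1) + norm5 q (c 4)) = - (norm5 q \<eta> + 1)"
    by (simp add: norm5_expand)
  thus "norm5 q (c 1) + norm5 q (c 4) = norm5 q \<eta> + 1"
    by (simp only: neg_equal_iff_equal)
qed

end

section \<open>Collineations between the two families\<close>

lemma field_automorphism_power:
  fixes \<sigma> :: "'a::field \<Rightarrow> 'a"
  assumes "field_automorphism \<sigma>"
  shows "\<sigma> 0 = 0" "\<sigma> 1 = 1" "\<sigma> (- x) = - \<sigma> x" "\<sigma> (x ^ n) = \<sigma> x ^ n" "\<sigma> x = 0 \<longleftrightarrow> x = 0"
    "\<sigma> (x - y) = \<sigma> x - \<sigma> y"
proof -
  have add: "\<sigma> (x + y) = \<sigma> x + \<sigma> y" and mult: "\<sigma> (x * y) = \<sigma> x * \<sigma> y" and inj: "inj \<sigma>" for x y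
    using assms by (auto simp: field_automorphism_def bij_def)
  show 0: "\<sigma> 0 = 0" using add[of 0 0] by (metis add.right_neutral add_left_cancel)
  show "\<sigma> x = 0 \<longleftrightarrow> x = 0" for x using inj_eq[OF inj, of x 0] 0 by simp
  show 1: "\<sigma> 1 = 1" using mult[of 1 1] inj_eq[OF inj, of 1 0] 0 by simp
  show neg: "\<sigma> (- x) = - \<sigma> x" for x using add[of x "- x"] 0 by (simp add: add_eq_0_iff)
  show "\<sigma> (x ^ n) = \<sigma> x ^ n" by (induction n) (simp_all add: 1 mult)
  show "\<sigma> (x - y) = \<sigma> x - \<sigma> y" using add[of x "- y"] neg[of y] by simp
qed

lemma semilinear_image_span:
  fixes A :: "'a::field ^ 2 ^ 2"
  assumes "field_automorphism \<sigma>"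
  shows "semilinear_map A \<sigma> ` vec.span {u} = vec.span {semilinear_map A \<sigma> u}"
proof -
  note \<sigma> = assms[unfolded field_automorphism_def]
  have hom: "semilinear_map A \<sigma> (k *s u) = \<sigma> k *s semilinear_map A \<sigma> u" for k
    using \<sigma> by (simp add: semilinear_map_def vec_eq_iff matrix_vector_mult_def sum_distrib_left mult_ac)
  have "semilinear_map A \<sigma> ` vec.span {u} = (\<lambda>k. \<sigma> k *s semilinear_map A \<sigma> u) ` UNIV"
    by (simp add: vec.span_singleton image_image hom)
  also have "\<dots> = (\<lambda>k. k *s semilinear_map A \<sigma> u) ` range \<sigma>"
    by (simp add: image_image)
  finally show ?thesis using \<sigma> by (simp add: vec.span_singleton bij_def)
qed

lemma span_eq_imp_slope_eq:
  fixes u v :: "'a::field ^ 2"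
  assumes "vec.span {u} = vec.span {v}" "v $ 1 \<noteq> 0"
  shows "u $ 1 \<noteq> 0" "u $ 2 / u $ 1 = v $ 2 / v $ 1"
proof -
  have "v \<in> vec.span {u}" using assms(1) vec.span_base[of v "{v}"] by simp
  then obtain k where "v = k *s u" by (auto simp: vec.span_singleton)
  with assms(2) show "u $ 1 \<noteq> 0" "u $ 2 / u $ 1 = v $ 2 / v $ 1" by auto
qed

context quintic
begin

definition U_vec :: "'a \<Rightarrow> 'a \<Rightarrow> 'a \<Rightarrow> 'a ^ 2" where
  "U_vec \<alpha> \<beta> x = vector [x - \<alpha> * x ^ (q ^ 2), x ^ q - \<beta> * x ^ (q ^ 2)]"

lemma U_vec_eq_0:
  assumes "\<alpha> ^ q \<noteq> \<beta> ^ (q + 1)" "U_vec \<alpha> \<beta> x = 0"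
  shows "x = 0"
proof -
  have 1: "x = \<alpha> * x ^ (q ^ 2)" and 2: "x ^ q = \<beta> * x ^ (q ^ 2)"
    using assms(2) by (auto simp: U_vec_def vec_eq_iff forall_2)
  have 3: "(x ^ (q ^ 2)) ^ q = x ^ (q ^ 3)" using frob_frob[of x 2 1] by simp
  have "\<alpha> ^ q * x ^ (q ^ 3) = x ^ q" using 1 3 by (metis power_mult_distrib)
  also have "\<dots> = \<beta> * (x ^ q) ^ q" using 2 by (simp add: power2_eq_square power_mult)
  also have "\<dots> = \<beta> ^ (q + 1) * x ^ (q ^ 3)" by (subst 2) (simp add: power_mult_distrib 3)
  finally have "x ^ (q ^ 3) = 0" using assms(1) by simp
  thus ?thesis by simp
qed

text \<open>
  The automorphism \<open>\<sigma>\<close> only replaces \<open>\<alpha>\<close> and \<open>\<beta>\<close> by their images, because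
  \<open>\<sigma>\<close> commutes with powers and the parameter \<open>x\<close> may be replaced by \<open>\<sigma> x\<close>; what remains of a
  collineation is a linear map.
\<close>

lemma image_L_ab:
  assumes "field_automorphism \<sigma>" "\<alpha> ^ q \<noteq> \<beta> ^ (q + 1)"
  shows "(\<lambda>P. semilinear_map A \<sigma> ` P) ` L_ab q \<alpha> \<beta>
       = {vec.span {A *v U_vec (\<sigma> \<alpha>) (\<sigma> \<beta>) y} | y. y \<noteq> 0}"
proof -
  note \<sigma> = assms(1)[unfolded field_automorphism_def] field_automorphism_power[OF assms(1)]
  have *: "semilinear_map A \<sigma> (U_vec \<alpha> \<beta> x) = A *v U_vec (\<sigma> \<alpha>) (\<sigma> \<beta>) (\<sigma> x)" for x
    unfolding semilinear_map_def using \<sigma>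
    by (intro arg_cong[of _ _ "(*v) A"]) (simp add: U_vec_def vec_eq_iff forall_2)
  have L: "L_ab q \<alpha> \<beta> = (\<lambda>x. vec.span {U_vec \<alpha> \<beta> x}) ` (-{0})"
  proof -
    have "U_vec \<alpha> \<beta> 0 = 0" using q_ge_2 by (simp add: U_vec_def vec_eq_iff forall_2 power_0_left)
    thus ?thesis using U_vec_eq_0[OF assms(2)]
      by (auto simp: L_ab_def linear_set_def U_ab_def U_vec_def[symmetric])
  qed
  have "\<sigma> ` (-{0}) = - \<sigma> ` {0}"
    using \<sigma>(1) by (intro bij_image_Compl_eq) auto
  hence "\<sigma> ` (-{0}) = -{0}" using \<sigma> by simp
  moreover have "(\<lambda>P. semilinear_map A \<sigma> ` P) ` L_ab q \<alpha> \<beta>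
       = (\<lambda>y. vec.span {A *v U_vec (\<sigma> \<alpha>) (\<sigma> \<beta>) y}) ` \<sigma> ` (-{0})"
    unfolding L image_image semilinear_image_span[OF assms(1)] * ..
  ultimately show ?thesis by (auto simp: image_iff)
qed

lemma L1_conv_LP: "L1 q \<eta> = {vec.span {vector [x, qpoly (LP \<eta>) x]} | x. x \<noteq> 0}"
  by (simp add: L1_def qpoly_def sum_lessThan_5 LP_def)

text \<open>
  The rows of \<open>A\<close> turn the parametrisation of \<open>U_ab q \<alpha> \<beta>\<close> into a pair of \<open>q\<close>-polynomials \<open>a\<close>, \<open>b\<close>
  with coefficients only in degrees \<open>1\<close>, \<open>q\<close>, \<open>q ^ 2\<close>.  No point of \<open>L1 q \<eta>\<close> has first coordinate
  \<open>0\<close>, so \<open>a\<close> is invertible and the image of \<open>U_ab q \<alpha> \<beta>\<close> is the graph of a \<open>q\<close>-polynomial \<open>c\<close> with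
  the slopes of \<open>LP \<eta>\<close>.  Hence \<open>c\<close> has only the coefficients \<open>c 1\<close> and \<open>c 4\<close>, and the comparison of
  coefficients in \<open>b = c \<circ> a\<close> forces \<open>\<beta> = 0\<close> and determines the norm of \<open>\<alpha>\<close> as
  \<open>- norm5 q (c 1) / norm5 q (c 4)\<close>.  If that were \<open>- 1\<close>, the two norms would be equal, and since
  their product is \<open>norm5 q \<eta>\<close> and their sum is \<open>norm5 q \<eta> + 1\<close>, both would be \<open>1\<close>.
\<close>

lemma linear_image_eq_L1_imp:
  fixes A :: "'a ^ 2 ^ 2"
  assumes L: "{vec.span {A *v U_vec \<alpha> \<beta> y} | y. y \<noteq> 0} = L1 q \<eta>"
    and \<eta>: "\<eta> \<noteq> 0" "norm5 q \<eta> \<noteq> 1"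
  shows "\<beta> = 0" "norm5 q \<alpha> \<noteq> - 1"
proof -
  define p r s t where prst: "p = A $ 1 $ 1" "r = A $ 1 $ 2" "s = A $ 2 $ 1" "t = A $ 2 $ 2"
  define a where "a = (\<lambda>i::nat. if i = 0 then p else if i = 1 then r
    else if i = 2 then - (p * \<alpha> + r * \<beta>) else 0)"
  define b where "b = (\<lambda>i::nat. if i = 0 then s else if i = 1 then t
    else if i = 2 then - (s * \<alpha> + t * \<beta>) else 0)"
  have image: "(A *v U_vec \<alpha> \<beta> y) $ 1 = qpoly a y" "(A *v U_vec \<alpha> \<beta> y) $ 2 = qpoly b y" for y
    by (simp_all add: matrix_vector_mult_def sum_2 U_vec_def qpoly_def sum_lessThan_5 a_def b_def
        prst algebra_simps)
  have ab: "qpoly a y \<noteq> 0 \<and> qpoly b y / qpoly a y \<in> slopes (LP \<eta>)" if "y \<noteq> 0" for y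
  proof -
    have "vec.span {A *v U_vec \<alpha> \<beta> y} \<in> L1 q \<eta>" using L that by blast
    then obtain x where x: "x \<noteq> 0"
      and span: "vec.span {A *v U_vec \<alpha> \<beta> y} = vec.span {vector [x, qpoly (LP \<eta>) x]}"
      unfolding L1_conv_LP by blast
    have "qpoly a y \<noteq> 0" "qpoly b y / qpoly a y = qpoly (LP \<eta>) x / x"
      using span_eq_imp_slope_eq[OF span] x by (simp_all add: image)
    thus ?thesis using x by (simp add: slopes_def)
  qed
  have ba: "\<exists>y. y \<noteq> 0 \<and> qpoly b y / qpoly a y = m" if m: "m \<in> slopes (LP \<eta>)" for m
  proof -
    obtain x where x: "x \<noteq> 0" "m = qpoly (LP \<eta>) x / x" using m by (auto simp: slopes_def)
    hence "vec.span {vector [x, qpoly (LP \<eta>) x]} \<in> {vec.span {A *v U_vec \<alpha> \<beta> y} | y. y \<noteq> 0}"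
      unfolding L L1_conv_LP by blast
    then obtain y where "y \<noteq> 0"
      and span: "vec.span {A *v U_vec \<alpha> \<beta> y} = vec.span {vector [x, qpoly (LP \<eta>) x]}"
      by auto
    moreover have "qpoly b y / qpoly a y = m"
      using span_eq_imp_slope_eq[OF span] x by (simp add: image)
    ultimately show ?thesis by blast
  qed
  have "inj (qpoly a)"
  proof (rule injI)
    fix x y assume "qpoly a x = qpoly a y"
    hence "qpoly a (x - y) = 0" using qpoly_add[of a "x - y" y] by simp
    thus "x = y" using ab[of "x - y"] by auto
  qed
  then obtain d where d: "\<And>x. qpoly d (qpoly a x) = x" using qpoly_inverse by blast
  have surj: "\<exists>y. x = qpoly a y" for x
    using \<open>inj (qpoly a)\<close> finite_UNIV_inj_surj[of "qpoly a"] by (auto simp: surj_def)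
  obtain c where c: "\<And>x. qpoly b (qpoly d x) = qpoly c x" using qpoly_comp by blast
  have comp: "qpoly b y = qpoly c (qpoly a y)" for y using c[of "qpoly a y"] d by simp
  have a_zero: "qpoly a 0 = 0" using q_ge_2 by (simp add: qpoly_def power_0_left)
  have "slopes c = slopes (LP \<eta>)"
  proof (intro equalityI subsetI)
    fix m assume "m \<in> slopes c"
    then obtain x where x: "x \<noteq> 0" "m = qpoly c x / x" by (auto simp: slopes_def)
    obtain y where "x = qpoly a y" using surj by blast
    with x ab[of y] a_zero show "m \<in> slopes (LP \<eta>)" by (cases "y = 0") (auto simp: comp)
  next
    fix m assume "m \<in> slopes (LP \<eta>)"
    then obtain y where "y \<noteq> 0" "m = qpoly c (qpoly a y) / qpoly a y"
      using ba[of m] by (auto simp: comp)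
    thus "m \<in> slopes c" using ab[of y] by (auto simp: slopes_def)
  qed
  note sc = coeffs_if_slopes_eq_LP[OF this \<eta>(1)]
  have nz: "c 1 \<noteq> 0" "c 4 \<noteq> 0" using sc(4) \<eta>(1) q_ge_2 by auto
  have "qpoly b y = qpoly (\<lambda>k. c 1 * twist a 1 k + c 4 * twist a 4 k) y" for y
  proof -
    have "qpoly b y = c 1 * qpoly a y ^ (q ^ 1) + c 4 * qpoly a y ^ (q ^ 4)"
      unfolding comp by (simp add: qpoly_def[of c] sum_lessThan_5 sc(1-3))
    also have "\<dots> = c 1 * qpoly (twist a 1) y + c 4 * qpoly (twist a 4) y"
      by (simp only: qpoly_frob[of 1] qpoly_frob[of 4])
    finally show ?thesis by (simp add: qpoly_def sum_lessThan_5 algebra_simps)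
  qed
  hence coeff: "b k = c 1 * twist a 1 k + c 4 * twist a 4 k" if "k < 5" for k
    using qpoly_coeff that by blast
  have z: "(0 :: 'a) ^ q = 0" "(0 :: 'a) ^ (q ^ 4) = 0" using q_ge_2 by (simp_all add: power_0_left)
  \<comment> \<open>\<open>a\<close> and \<open>b\<close> have no coefficients \<open>3\<close> and \<open>4\<close>; in \<open>c \<circ> a\<close> the former is \<open>c 1\<close> times a power of
    \<open>a 2\<close>, the latter \<open>c 4\<close> times a power of \<open>a 0\<close>\<close>
  have \<gamma>: "p * \<alpha> + r * \<beta> = 0"
    using coeff[of 3] nz frob_minus[of "p * \<alpha> + r * \<beta>" 1] by (simp add: twist_def a_def b_def z)
  have p: "p = 0"
    using coeff[of 4] nz by (simp add: twist_def a_def b_def z)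
  have t: "t = 0"
    using coeff[of 1] \<gamma> p q_ge_2 by (simp add: twist_def a_def b_def power_0_left)
  have s: "s = c 4 * r ^ (q ^ 4)"
    using coeff[of 0] by (simp add: twist_def a_def b_def z)
  have s\<alpha>: "- (s * \<alpha>) = c 1 * r ^ (q ^ 1)"
    using coeff[of 2] t by (simp add: twist_def a_def b_def z)
  have r: "r \<noteq> 0"
    using ab[of 1] p by (auto simp: qpoly_def sum_lessThan_5 a_def)
  show "\<beta> = 0" using \<gamma> p r by simp
  show "norm5 q \<alpha> \<noteq> - 1"
  proof
    assume N: "norm5 q \<alpha> = - 1"
    have "norm5 q (- (s * \<alpha>)) = norm5 q (c 4) * norm5 q r"
      by (simp only: norm5_minus norm5_mult N s norm5_frob) simp
    moreover have "norm5 q (- (s * \<alpha>)) = norm5 q (c 1) * norm5 q r"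
      by (simp only: s\<alpha> norm5_mult norm5_frob)
    ultimately have eq: "norm5 q (c 4) = norm5 q (c 1)"
      using r by (simp add: norm5_eq_0_iff)
    define n where "n = norm5 q (c 1)"
    have "norm5 q \<eta> = n * n"
      using norm5_mult[of q "c 1" "c 4 ^ q"] norm5_frob[of "c 4" 1] by (simp add: eq n_def flip: sc(4))
    moreover have "n + n = norm5 q \<eta> + 1" using sc(5) by (simp add: eq n_def)
    ultimately have "(n - 1) * (n - 1) = 0" by (simp add: algebra_simps)
    hence "n = 1" by simp
    thus False using \<open>norm5 q \<eta> = n * n\<close> \<eta>(2) by simp
  qed
qed

text \<open>
  Swapping the coordinates of \<open>(x - \<alpha> * x ^ (q ^ 2), x ^ q)\<close> and substituting \<open>y = x ^ q\<close>, that is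
  \<open>x = y ^ (q ^ 4)\<close>, gives \<open>(y, - \<alpha> * y ^ q + y ^ (q ^ 4))\<close>.
\<close>

lemma L_ab_0_equivalent_L1:
  fixes \<alpha> :: 'a
  assumes "\<alpha> \<noteq> 0"
  shows "PGammaL_equivalent (L_ab q \<alpha> 0) (L1 q (- \<alpha>))"
proof -
  define A :: "'a ^ 2 ^ 2" where "A = vector [vector [0, 1], vector [1, 0]]"
  have "A ** A = mat 1"
    by (simp add: A_def matrix_matrix_mult_def vec_eq_iff forall_2 sum_2 mat_def)
  hence inv: "invertible A" unfolding invertible_def by blast
  have id: "field_automorphism (id :: 'a \<Rightarrow> 'a)" by (simp add: field_automorphism_def)
  have A: "A *v U_vec \<alpha> 0 y = vector [y ^ q, - \<alpha> * (y ^ q) ^ q + (y ^ q) ^ (q ^ 4)]" for y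
    using frob_frob[of y 1 1] frob_frob[of y 1 4]
    by (simp add: A_def U_vec_def matrix_vector_mult_def vec_eq_iff forall_2 sum_2
        power2_eq_square)
  have surj: "\<exists>y. y \<noteq> 0 \<and> x = y ^ q" if "x \<noteq> 0" for x :: 'a
    using that frob_frob[of x 4 1] by (intro exI[of _ "x ^ (q ^ 4)"]) simp
  have "(\<lambda>P. semilinear_map A id ` P) ` L_ab q \<alpha> 0 = {vec.span {A *v U_vec \<alpha> 0 y} | y. y \<noteq> 0}"
    using image_L_ab[OF id, of \<alpha> 0 A] \<open>\<alpha> \<noteq> 0\<close> by simp
  also have "\<dots> = L1 q (- \<alpha>)"
  proof (intro equalityI subsetI)
    fix P assume "P \<in> {vec.span {A *v U_vec \<alpha> 0 y} | y. y \<noteq> 0}"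
    then obtain y where "y \<noteq> 0" "P = vec.span {A *v U_vec \<alpha> 0 y}" by blast
    thus "P \<in> L1 q (- \<alpha>)" unfolding A L1_def by (intro CollectI exI[of _ "y ^ q"]) simp
  next
    fix P assume "P \<in> L1 q (- \<alpha>)"
    then obtain x where x: "x \<noteq> 0" "P = vec.span {vector [x, - \<alpha> * x ^ q + x ^ (q ^ 4)]}"
      unfolding L1_def by blast
    obtain y where "y \<noteq> 0" "x = y ^ q" using surj[OF x(1)] by blast
    with x show "P \<in> {vec.span {A *v U_vec \<alpha> 0 y} | y. y \<noteq> 0}" unfolding A by blast
  qed
  finally show ?thesis unfolding PGammaL_equivalent_def PGammaL_def using inv id by blast
qed

end

theorem lemma5p1:
  fixes q :: nat and \<alpha> \<beta> :: "'a::{field, finite}"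
  assumes "primepow q"
    and "CARD('a) = q ^ 5"
    and "\<alpha> ^ q \<noteq> \<beta> ^ (q + 1)"
    and "maximum_scattered q (U_ab q \<alpha> \<beta>)"
  shows "(\<exists>\<eta>::'a. norm5 q \<eta> \<notin> {0, 1} \<and> PGammaL_equivalent (L_ab q \<alpha> \<beta>) (L1 q \<eta>))
         \<longleftrightarrow> \<beta> = 0 \<and> norm5 q \<alpha> \<noteq> -1"
proof -
  interpret quintic q "TYPE('a)" by unfold_locales fact+
  show ?thesis
  proof (intro iffI)
    assume "\<exists>\<eta>::'a. norm5 q \<eta> \<notin> {0, 1} \<and> PGammaL_equivalent (L_ab q \<alpha> \<beta>) (L1 q \<eta>)"
    then obtain \<eta> :: 'a and A \<sigma> where \<eta>: "norm5 q \<eta> \<noteq> 0" "norm5 q \<eta> \<noteq> 1"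
      and \<sigma>: "field_automorphism \<sigma>" and eq: "(\<lambda>P. semilinear_map A \<sigma> ` P) ` L_ab q \<alpha> \<beta> = L1 q \<eta>"
      by (auto simp: PGammaL_equivalent_def PGammaL_def)
    note \<sigma>s = field_automorphism_power[OF \<sigma>]
    have "{vec.span {A *v U_vec (\<sigma> \<alpha>) (\<sigma> \<beta>) y} | y. y \<noteq> 0} = L1 q \<eta>"
      using image_L_ab[OF \<sigma> assms(3), of A] eq by simp
    from linear_image_eq_L1_imp[OF this] \<eta> have "\<sigma> \<beta> = 0" "norm5 q (\<sigma> \<alpha>) \<noteq> - 1"
      by (auto simp: norm5_eq_0_iff)
    moreover have "norm5 q (\<sigma> \<alpha>) = \<sigma> (norm5 q \<alpha>)"
      using \<sigma> \<sigma>s by (simp add: norm5_expand field_automorphism_def)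
    ultimately show "\<beta> = 0 \<and> norm5 q \<alpha> \<noteq> - 1" using \<sigma>s by auto
  next
    assume *: "\<beta> = 0 \<and> norm5 q \<alpha> \<noteq> - 1"
    have "\<alpha> \<noteq> 0" using assms(3) * q_ge_2 by auto
    hence "PGammaL_equivalent (L_ab q \<alpha> \<beta>) (L1 q (- \<alpha>))"
      using L_ab_0_equivalent_L1 * by simp
    moreover have "norm5 q (- \<alpha>) \<notin> {0, 1}"
      using * \<open>\<alpha> \<noteq> 0\<close> by (auto simp: norm5_minus norm5_eq_0_iff minus_equation_iff)
    ultimately show "\<exists>\<eta>::'a. norm5 q \<eta> \<notin> {0, 1} \<and> PGammaL_equivalent (L_ab q \<alpha> \<beta>) (L1 q \<eta>)"
      by blast
  qed
qed
end
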